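(* Let $\mathcal{G}$ be the set of links of a directed unweighted network without self-links on the finite node set $N$. For any nodes $i,j\in N$, any set of nodes $A\subseteq N$, and any set of links $\mathcal{L}\subseteq\mathcal{G}$, $$\mathcal{W}_{ij}(A)=\bigcup_{l\in A}\Big\{\big(\mathcal{W}_{il}(\lnot A)\setminus\{(i)\}\big)\odot\big(\mathcal{W}_{lj}\setminus\{(j)\}\big)\Big\},$$ $$\mathcal{W}_{ij}(\mathcal{L})=\bigcup_{(l,k)\in\mathcal{L}}\Big\{\mathcal{W}_{il}(\lnot\mathcal{L})\odot (l,k)\odot\mathcal{W}_{kj}\Big\}.$$ Moreover, these decompositions are unique: every $w\in\mathcal{W}_{ij}(A)$ can be written as $w=w_1\odot w_2$ with $l\in A$, $w_1\in\mathcal{W}_{il}(\lnot A)\setminus\{(i)\}$, $w_2\in\mathcal{W}_{lj}\setminus\{(j)\}$ for exactly one choice of $(l,w_1,w_2)$; and every $w\in\mathcal{W}_{ij}(\mathcal{L})$ can be written as $w=w_1\odot(l,k)\odot w_2$ with $(l,k)\in\mathcal{L}$, $w_1\in\mathcal{W}_{il}(\lnot\mathcal{L})$, $w_2\in\mathcal{W}_{kj}$ for exactly one choice of $((l,k),w_1,w_2)$.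
   Context: $N=\{1,\dots,n\}$; the network has adjacency matrix $\mathbf{G}=(g_{ij})$ with $g_{ij}\in\{0,1\}$, $g_{ii}=0$, and $\mathcal{G}=\{(i,j):g_{ij}=1\}$. A walk is a node sequence $w=(i_0,\dots,i_K)$, $K\ge 0$, with $(i_k,i_{k+1})\in\mathcal{G}$ for $k=0,\dots,K-1$; its length is $K$. For each node $i$, $(i)$ is the walk of length $0$ at $i$. $\mathcal{W}_{ij}$ is the set of walks with $i_0=i$ and $i_K=j$ (so $(i)\in\mathcal{W}_{ij}$ iff $i=j$). For $A\subseteq N$: $\mathcal{W}_{ij}(A)$ is the set of $w=(i_0,\dots,i_K)\in\mathcal{W}_{ij}$ with $i_k\in A$ for some $k\in\{1,\dots,K-1\}$; $\mathcal{W}_{ij}(\lnot A)$ is the set of $w\in\mathcal{W}_{ij}$ with $i_k\notin A$ for all $k\in\{1,\dots,K-1\}$. For $\mathcal{L}\subseteq\mathcal{G}$: $\mathcal{W}_{ij}(\mathcal{L})$ is the set of $w\in\mathcal{W}_{ij}$ with $(i_k,i_{k+1})\in\mathcal{L}$ for some $k\in\{0,\dots,K-1\}$; $\mathcal{W}_{ij}(\lnot\mathcal{L})$ is the set of $w\in\mathcal{W}_{ij}$ with $(i_k,i_{k+1})\notin\mathcal{L}$ for all $k\in\{0,\dots,K-1\}$. Concatenation: if $w=(i_0,\dots,i_K)$ and $w'=(j_0,\dots,j_T)$ with $i_K=j_0$, then $w\odot w'=(i_0,\dots,i_K,j_1,\dots,j_T)$ (when $i_K\ne j_0$ the concatenation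 is the empty walk; this does not occur in the sets above). For sets of walks, $\mathcal{W}_1\odot\mathcal{W}_2=\{w_1\odot w_2: w_1\in\mathcal{W}_1,w_2\in\mathcal{W}_2\}$. In the second formula $(l,k)$ denotes the singleton set containing the length-one walk $(l,k)$. Removing $(i)$ (or $(j)$) from a set not containing it has no effect. *)

theory Defs
  imports Main
begin

definition nodes :: "nat \<Rightarrow> nat set" where
  "nodes n = {1..n}"

definition adjacency_matrix :: "nat \<Rightarrow> (nat \<Rightarrow> nat \<Rightarrow> nat) \<Rightarrow> bool" where
  "adjacency_matrix n g \<longleftrightarrow>
     (\<forall>i\<in>nodes n. \<forall>j\<in>nodes n. g i j \<in> {0, 1}) \<and> (\<forall>i\<in>nodes n. g i i = 0)"

definition links :: "nat \<Rightarrow> (nat \<Rightarrow> nat \<Rightarrow> nat) \<Rightarrow> (nat \<times> nat) set" where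
  "links n g = {(i, j). i \<in> nodes n \<and> j \<in> nodes n \<and> g i j = 1}"

text \<open>A walk \<open>(i\<^sub>0, \<dots>, i\<^sub>K)\<close> is the list of its \<open>K + 1\<close> nodes, so \<open>w ! k\<close> is \<open>i\<^sub>k\<close>. It is never the
  empty list; the empty list only serves as the empty walk returned by an undefined concatenation.\<close>

definition walk_length :: "nat list \<Rightarrow> nat" where
  "walk_length w = length w - 1"

definition is_walk :: "nat \<Rightarrow> (nat \<Rightarrow> nat \<Rightarrow> nat) \<Rightarrow> nat list \<Rightarrow> bool" where
  "is_walk n g w \<longleftrightarrow>
     w \<noteq> [] \<and> set w \<subseteq> nodes n \<and> (\<forall>k<walk_length w. (w ! k, w ! (k + 1)) \<in> links n g)"

definition walks :: "nat \<Rightarrow> (nat \<Rightarrow> nat \<Rightarrow> nat) \<Rightarrow> nat \<Rightarrow> nat \<Rightarrow> nat list set" where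
  "walks n g i j = {w. is_walk n g w \<and> w ! 0 = i \<and> w ! walk_length w = j}"

text \<open>For sets of nodes only the intermediate positions \<open>1, \<dots>, K - 1\<close> count; the end points may
  lie in \<open>A\<close> or not.\<close>

definition walks_via_nodes ::
    "nat \<Rightarrow> (nat \<Rightarrow> nat \<Rightarrow> nat) \<Rightarrow> nat set \<Rightarrow> nat \<Rightarrow> nat \<Rightarrow> nat list set" where
  "walks_via_nodes n g A i j = {w \<in> walks n g i j. \<exists>k\<in>{1..<walk_length w}. w ! k \<in> A}"

definition walks_avoiding_nodes ::
    "nat \<Rightarrow> (nat \<Rightarrow> nat \<Rightarrow> nat) \<Rightarrow> nat set \<Rightarrow> nat \<Rightarrow> nat \<Rightarrow> nat list set" where
  "walks_avoiding_nodes n g A i j = {w \<in> walks n g i j. \<forall>k\<in>{1..<walk_length w}. w ! k \<notin> A}"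

definition walks_via_links ::
    "nat \<Rightarrow> (nat \<Rightarrow> nat \<Rightarrow> nat) \<Rightarrow> (nat \<times> nat) set \<Rightarrow> nat \<Rightarrow> nat \<Rightarrow> nat list set" where
  "walks_via_links n g L i j =
     {w \<in> walks n g i j. \<exists>k\<in>{0..<walk_length w}. (w ! k, w ! (k + 1)) \<in> L}"

definition walks_avoiding_links ::
    "nat \<Rightarrow> (nat \<Rightarrow> nat \<Rightarrow> nat) \<Rightarrow> (nat \<times> nat) set \<Rightarrow> nat \<Rightarrow> nat \<Rightarrow> nat list set" where
  "walks_avoiding_links n g L i j =
     {w \<in> walks n g i j. \<forall>k\<in>{0..<walk_length w}. (w ! k, w ! (k + 1)) \<notin> L}"

definition walk_concat :: "nat list \<Rightarrow> nat list \<Rightarrow> nat list" (infixl "\<odot>" 75) where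
  "w \<odot> w' = (if w \<noteq> [] \<and> w' \<noteq> [] \<and> last w = hd w' then w @ tl w' else [])"

definition walk_set_concat :: "nat list set \<Rightarrow> nat list set \<Rightarrow> nat list set"
    (infixl "\<odot>\<^sub>S" 75) where
  "W1 \<odot>\<^sub>S W2 = {w1 \<odot> w2 | w1 w2. w1 \<in> W1 \<and> w2 \<in> W2}"

end

theory Submission
  imports Defs
begin

text \<open>A decomposition of a walk is the choice of a cutting position: at the first intermediate node
  in \<open>A\<close>, respectively at the first link in \<open>L\<close>. Conversely every decomposition cuts there, because
  its first factor avoids \<open>A\<close> or \<open>L\<close>. For \<open>A\<close>, excluding the walks of length \<open>0\<close> says that the cut is
  at an intermediate position.\<close>

text \<open>The two pieces share the node at position \<open>k\<close>, hence
  \<open>take (Suc k)\<close> next to \<open>drop k\<close>: no link is lost. The links at positions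
  below \<open>k\<close> lie in the first piece, the remaining ones in the second with positions
  shifted by \<open>k\<close>.\<close>

lemma walks_iff_take_drop:
  assumes "k \<le> walk_length w" "w \<noteq> []"
  shows "w \<in> walks n g i j \<longleftrightarrow>
    take (Suc k) w \<in> walks n g i (w ! k) \<and> drop k w \<in> walks n g (w ! k) j"
proof -
  have k: "k < length w" using assms by (cases w) (auto simp: walk_length_def)
  have len: "walk_length (take (Suc k) w) = k" "walk_length (drop k w) = walk_length w - k"
    using k by (auto simp: walk_length_def)
  have "set (take (Suc k) w) \<union> set (drop k w) = set w"
  proof
    have "set w = set (take k w) \<union> set (drop k w)"
      by (metis append_take_drop_id set_append)
    then show "set w \<subseteq> set (take (Suc k) w) \<union> set (drop k w)"
      using set_take_subset_set_take[of k "Suc k" w] by auto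
  qed (use set_take_subset set_drop_subset in fast)
  then have sets: "set w \<subseteq> nodes n \<longleftrightarrow>
      set (take (Suc k) w) \<subseteq> nodes n \<and> set (drop k w) \<subseteq> nodes n"
    by blast
  \<comment> \<open>Splitting the range of positions is proved for an arbitrary predicate and then
    used for the link condition.\<close>
  have "(\<forall>m<walk_length w. Q m) \<longleftrightarrow> (\<forall>m<k. Q m) \<and> (\<forall>m<walk_length w - k. Q (k + m))"
    for Q :: "nat \<Rightarrow> bool"
  proof (intro iffI conjI allI impI)
    fix m assume Q: "(\<forall>m<k. Q m) \<and> (\<forall>m<walk_length w - k. Q (k + m))" and m: "m < walk_length w"
    show "Q m"
    proof (cases "m < k")
      case False
      then have "m - k < walk_length w - k" using m by simp
      then have "Q (k + (m - k))" using Q by blast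
      then show ?thesis using False by simp
    qed (use Q in blast)
  qed (use assms(1) in auto)
  from this[of "\<lambda>m. (w ! m, w ! Suc m) \<in> links n g"] show ?thesis
    using k assms sets by (auto simp: walks_def is_walk_def len)
qed

text \<open>The length of \<open>w1\<close> fixes the cutting position and thereby both factors.
  Factorizations of \<open>w\<close> thus become positions in \<open>w\<close>, so that uniqueness
  of a factorization turns into uniqueness of a number.\<close>

lemma walk_concat_split_iff:
  "w1 \<in> walks n g i l \<and> w2 \<in> walks n g l j \<and> w = w1 \<odot> w2 \<longleftrightarrow>
   w \<in> walks n g i j \<and>
     (\<exists>k\<le>walk_length w. l = w ! k \<and> w1 = take (Suc k) w \<and> w2 = drop k w)"
  (is "?L \<longleftrightarrow> ?R")
proof
  assume L: ?L
  define k where "k = walk_length w1"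
  have ne: "w1 \<noteq> []" "w2 \<noteq> []" and l: "last w1 = l" "hd w2 = l"
    using L by (auto simp: walks_def is_walk_def walk_length_def hd_conv_nth last_conv_nth)
  have len1: "length w1 = Suc k" using ne by (cases w1) (auto simp: k_def walk_length_def)
  have w: "w = w1 @ tl w2" using L ne l by (simp add: walk_concat_def)
  have t: "w1 = take (Suc k) w" using w len1 by simp
  \<comment> \<open>The shared node can be counted with \<open>w2\<close> instead of
    \<open>w1\<close>; this exhibits \<open>w2\<close> as a suffix of \<open>w\<close>.\<close>
  have "w = butlast w1 @ w2" using w ne l
    by (metis append.assoc append_Cons append_Nil append_butlast_last_id list.collapse)
  then have d: "w2 = drop k w" using len1 by simp
  have wk: "l = w ! k" using w l ne len1 by (simp add: nth_append last_conv_nth)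
  have kl: "k \<le> walk_length w" using w len1 by (simp add: walk_length_def)
  show ?R using L walks_iff_take_drop[OF kl, of n g i j] t d wk kl ne by auto
next
  assume ?R
  then obtain k where k: "k \<le> walk_length w" "l = w ! k" "w1 = take (Suc k) w" "w2 = drop k w"
    and w: "w \<in> walks n g i j" by blast
  have ne: "w \<noteq> []" using w by (auto simp: walks_def is_walk_def)
  have kl: "k < length w" using k ne by (cases w) (auto simp: walk_length_def)
  have "last w1 = hd w2" using k kl by (simp add: take_Suc_conv_app_nth hd_drop_conv_nth)
  moreover have "tl w2 = drop (Suc k) w" using k by (simp add: drop_Suc tl_drop)
  then have "w1 @ tl w2 = w" using k by simp
  ultimately have "w = w1 \<odot> w2" using k kl ne by (auto simp: walk_concat_def)
  then have "take (Suc k) w \<odot> drop k w = w" using k by simp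
  then show ?L unfolding k(2-4) using walks_iff_take_drop[OF k(1) ne] w by simp
qed

lemma link_walk_iff: "[l, k] \<in> walks n g l' k' \<longleftrightarrow> l' = l \<and> k' = k \<and> (l, k) \<in> links n g"
  by (auto simp: walks_def is_walk_def walk_length_def links_def)

text \<open>Excluding the trivial walks gives \<open>0 < k\<close> and
  \<open>k < walk_length w\<close>. The first factor avoids \<open>A\<close> at its positions
  strictly between 0 and \<open>k\<close>, so \<open>k\<close> is the first intermediate position
  whose node is in \<open>A\<close>.\<close>

lemma walk_node_split_iff:
  "l \<in> A \<and> w1 \<in> walks_avoiding_nodes n g A i l - {[i]} \<and> w2 \<in> walks n g l j - {[j]} \<and>
     w = w1 \<odot> w2 \<longleftrightarrow>
   w \<in> walks n g i j \<and>
     (\<exists>k. (k < walk_length w \<and> 0 < k \<and> w ! k \<in> A \<and> (\<forall>m<k. \<not> (0 < m \<and> w ! m \<in> A))) \<and>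
       (l, w1, w2) = (w ! k, take (Suc k) w, drop k w))"
  (is "?L \<longleftrightarrow> ?R")
proof -
  \<comment> \<open>Removing \<open>[i]\<close> and \<open>[j]\<close> becomes a condition on
    lengths, which the cut translates into bounds on \<open>k\<close>.\<close>
  have "w1 \<in> walks n g i l \<Longrightarrow> w1 = [i] \<longleftrightarrow> walk_length w1 = 0"
    "w2 \<in> walks n g l j \<Longrightarrow> w2 = [j] \<longleftrightarrow> walk_length w2 = 0"
    by (cases w1; auto simp: walks_def is_walk_def walk_length_def)
      (cases w2; auto simp: walks_def is_walk_def walk_length_def)
  then have "?L \<longleftrightarrow> l \<in> A \<and> walk_length w1 \<noteq> 0 \<and> walk_length w2 \<noteq> 0 \<and>
      (\<forall>m\<in>{1..<walk_length w1}. w1 ! m \<notin> A) \<and>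
      w1 \<in> walks n g i l \<and> w2 \<in> walks n g l j \<and> w = w1 \<odot> w2"
    by (auto simp: walks_avoiding_nodes_def)
  also have "\<dots> \<longleftrightarrow> w \<in> walks n g i j \<and> (\<exists>k\<le>walk_length w. l \<in> A \<and>
      walk_length w1 \<noteq> 0 \<and> walk_length w2 \<noteq> 0 \<and> (\<forall>m\<in>{1..<walk_length w1}. w1 ! m \<notin> A) \<and>
      l = w ! k \<and> w1 = take (Suc k) w \<and> w2 = drop k w)"
    unfolding walk_concat_split_iff by blast
  also have "\<dots> \<longleftrightarrow> ?R"
  proof -
    have "k \<le> walk_length w \<and> l \<in> A \<and>
        walk_length w1 \<noteq> 0 \<and> walk_length w2 \<noteq> 0 \<and> (\<forall>m\<in>{1..<walk_length w1}. w1 ! m \<notin> A) \<and>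
        l = w ! k \<and> w1 = take (Suc k) w \<and> w2 = drop k w \<longleftrightarrow>
      (k < walk_length w \<and> 0 < k \<and> w ! k \<in> A \<and> (\<forall>m<k. \<not> (0 < m \<and> w ! m \<in> A))) \<and>
        (l, w1, w2) = (w ! k, take (Suc k) w, drop k w)" (is "?a \<longleftrightarrow> ?b") for k
    \<comment> \<open>Either side forces these cut equations, so only the case in which they hold
      needs work.\<close>
    proof (cases "k \<le> walk_length w \<and> l = w ! k \<and> w1 = take (Suc k) w \<and> w2 = drop k w")
      case True
      \<comment> \<open>That \<open>w\<close> is a walk is not among the facts here. For the empty
        list \<open>walk_length\<close> is 0 by truncated subtraction, and both sides fail.\<close>
      then have "w = [] \<or> walk_length w1 = k \<and> walk_length w2 = walk_length w - k"
        by (cases w) (auto simp: walk_length_def)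
      moreover have "(\<forall>m\<in>{1..<k}. w1 ! m \<notin> A) \<longleftrightarrow> (\<forall>m<k. \<not> (0 < m \<and> w ! m \<in> A))"
        using True by force
      ultimately show ?thesis using True by (auto simp: walk_length_def)
    next
      case False
      then have "\<not> ?a" "\<not> ?b" by auto
      then show ?thesis by blast
    qed
    then show ?thesis by (simp only:)
  qed
  finally show ?thesis .
qed

text \<open>A link is isolated by two cuts, one after it and one before it, at the neighbouring
  positions \<open>Suc p\<close> and \<open>p\<close>. The inclusion of \<open>L\<close> in the set
  of links makes \<open>[l, k]\<close> a walk, so that \<open>walk_concat_split_iff\<close> applies
  to both cuts.\<close>

lemma walk_link_split_iff:
  assumes "L \<subseteq> links n g"
  shows "(l, k) \<in> L \<and> w1 \<in> walks_avoiding_links n g L i l \<and> w2 \<in> walks n g k j \<and>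
     w = w1 \<odot> [l, k] \<odot> w2 \<longleftrightarrow>
   w \<in> walks n g i j \<and>
     (\<exists>p. (p < walk_length w \<and> (w ! p, w ! Suc p) \<in> L \<and> (\<forall>m<p. (w ! m, w ! Suc m) \<notin> L)) \<and>
       ((l, k), w1, w2) = ((w ! p, w ! Suc p), take (Suc p) w, drop (Suc p) w))"
  (is "?L \<longleftrightarrow> ?R")
proof
  assume L: ?L
  \<comment> \<open>Concatenation associates to the left, so \<open>v\<close> is the first factor of
    the outer cut.\<close>
  define v where "v = w1 \<odot> [l, k]"
  have w1: "w1 \<in> walks n g i l" and av: "\<forall>m\<in>{0..<walk_length w1}. (w1 ! m, w1 ! (m + 1)) \<notin> L"
    using L by (auto simp: walks_avoiding_links_def)
  have "w1 \<in> walks n g i l \<and> [l, k] \<in> walks n g l k \<and> v = w1 \<odot> [l, k]"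
    using w1 L assms by (auto simp: link_walk_iff v_def)
  then obtain p where v: "v \<in> walks n g i k" and p: "p \<le> walk_length v" "l = v ! p"
      "w1 = take (Suc p) v" "[l, k] = drop p v"
    unfolding walk_concat_split_iff by blast
  have "v \<in> walks n g i k \<and> w2 \<in> walks n g k j \<and> w = v \<odot> w2" using L v by (simp add: v_def)
  then obtain q where w: "w \<in> walks n g i j" and q: "q \<le> walk_length w" "k = w ! q"
      "v = take (Suc q) w" "w2 = drop q w"
    unfolding walk_concat_split_iff by blast
  \<comment> \<open>Comparing lengths relates the two cuts: \<open>v\<close> has
    \<open>q + 1\<close> nodes, of which exactly two remain from position \<open>p\<close>
    on.\<close>
  have "length v = Suc q" using q w
    by (cases w) (auto simp: walk_length_def walks_def is_walk_def)
  moreover have "length v - p = 2" using arg_cong[OF p(4), of length] by simp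
  ultimately have qp: "q = Suc p" by simp
  have c: "w1 = take (Suc p) w" "l = w ! p" "p < walk_length w" using p q qp by auto
  have "\<forall>m<p. (w ! m, w ! Suc m) \<notin> L"
    using av c by (simp add: walk_length_def)
  moreover have "(w ! p, w ! Suc p) \<in> L" using L c q qp by simp
  moreover have "w2 = drop (Suc p) w" "k = w ! Suc p" using q qp by simp_all
  ultimately show ?R using w c by blast
next
  assume ?R
  then obtain p where w: "w \<in> walks n g i j" and p: "p < walk_length w" "(w ! p, w ! Suc p) \<in> L"
      "\<forall>m<p. (w ! m, w ! Suc m) \<notin> L" "l = w ! p" "k = w ! Suc p"
      "w1 = take (Suc p) w" "w2 = drop (Suc p) w" by blast
  \<comment> \<open>The prefix of \<open>w\<close> that ends with the link at position
    \<open>p\<close>; cutting it at \<open>p\<close> splits off \<open>[l, k]\<close>.\<close>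
  define v where "v = take (Suc (Suc p)) w"
  have v: "v \<in> walks n g i k" "w2 \<in> walks n g k j" "w = v \<odot> w2"
    using iffD2[OF walk_concat_split_iff[of v n g i k w2 j w]] w p Suc_leI[OF p(1)]
    unfolding v_def by blast+
  have "length w > Suc p" using p by (auto simp: walk_length_def)
  then have "p \<le> walk_length v" "l = v ! p" "w1 = take (Suc p) v" "[l, k] = drop p v"
    using p by (auto simp: v_def walk_length_def take_Suc_conv_app_nth nth_append)
  then have "w1 \<in> walks n g i l" "v = w1 \<odot> [l, k]"
    using iffD2[OF walk_concat_split_iff[of w1 n g i l "[l, k]" k v]] v by blast+
  moreover have "\<forall>m\<in>{0..<walk_length w1}. (w1 ! m, w1 ! (m + 1)) \<notin> L"
    using p by (simp add: walk_length_def)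
  moreover have "(l, k) \<in> L" using p by simp
  ultimately show ?L using v unfolding walks_avoiding_links_def by blast
qed

text \<open>The least index satisfying \<open>P\<close> is the only one with no smaller index
  satisfying \<open>P\<close>, so its image under any \<open>f\<close> is unique. Here
  \<open>f\<close> will send a cutting position to the tuple of the decomposition.\<close>

lemma ex1_first_image:
  fixes P :: "nat \<Rightarrow> bool"
  assumes "\<exists>k<N. P k"
  shows "\<exists>!d. \<exists>k. (k < N \<and> P k \<and> (\<forall>m<k. \<not> P m)) \<and> d = f k"
proof -
  \<comment> \<open>Minimality is first obtained only among indices below \<open>N\<close>; it
    extends to every \<open>m < k\<close> because \<open>k < N\<close>.\<close>
  obtain k where "P k" "k < N" "\<forall>m<k. \<not> P m"
    using assms exists_least_iff[of "\<lambda>k. k < N \<and> P k"] by (meson order_less_trans)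
  then show ?thesis by (metis linorder_neqE_nat)
qed

theorem lemma1:
  fixes n :: nat and g :: "nat \<Rightarrow> nat \<Rightarrow> nat" and i j :: nat
    and A :: "nat set" and L :: "(nat \<times> nat) set"
  assumes "adjacency_matrix n g"
    and "i \<in> nodes n" and "j \<in> nodes n"
    and "A \<subseteq> nodes n"
    and "L \<subseteq> links n g"
  shows "walks_via_nodes n g A i j =
           (\<Union>l\<in>A. (walks_avoiding_nodes n g A i l - {[i]}) \<odot>\<^sub>S (walks n g l j - {[j]})) \<and>
         walks_via_links n g L i j =
           (\<Union>(l, k)\<in>L. walks_avoiding_links n g L i l \<odot>\<^sub>S {[l, k]} \<odot>\<^sub>S walks n g k j) \<and>
         (\<forall>w\<in>walks_via_nodes n g A i j.
           \<exists>!d. case d of (l, w1, w2) \<Rightarrow>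
             l \<in> A \<and> w1 \<in> walks_avoiding_nodes n g A i l - {[i]} \<and> w2 \<in> walks n g l j - {[j]} \<and>
             w = w1 \<odot> w2) \<and>
         (\<forall>w\<in>walks_via_links n g L i j.
           \<exists>!d. case d of ((l, k), w1, w2) \<Rightarrow>
             (l, k) \<in> L \<and> w1 \<in> walks_avoiding_links n g L i l \<and> w2 \<in> walks n g k j \<and>
             w = w1 \<odot> [l, k] \<odot> w2)"
proof (intro conjI ballI)
  let ?N = "\<lambda>w d. case d of (l, w1, w2) \<Rightarrow> l \<in> A \<and> w1 \<in> walks_avoiding_nodes n g A i l - {[i]} \<and>
    w2 \<in> walks n g l j - {[j]} \<and> w = w1 \<odot> w2"
  let ?K = "\<lambda>w d. case d of ((l, k), w1, w2) \<Rightarrow> (l, k) \<in> L \<and> w1 \<in> walks_avoiding_links n g L i l \<and>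
    w2 \<in> walks n g k j \<and> w = w1 \<odot> [l, k] \<odot> w2"
  \<comment> \<open>The bound \<open>0 < k\<close> is grouped with membership in \<open>A\<close>,
    so that their conjunction can serve as the predicate of \<open>ex1_first_image\<close>.\<close>
  have N: "?N w d \<longleftrightarrow> w \<in> walks n g i j \<and>
     (\<exists>k. (k < walk_length w \<and> (0 < k \<and> w ! k \<in> A) \<and> (\<forall>m<k. \<not> (0 < m \<and> w ! m \<in> A))) \<and>
       d = (w ! k, take (Suc k) w, drop k w))" for w d
    by (cases d) (simp only: prod.case walk_node_split_iff conj_assoc)
  have K: "?K w d \<longleftrightarrow> w \<in> walks n g i j \<and>
     (\<exists>p. (p < walk_length w \<and> (w ! p, w ! Suc p) \<in> L \<and> (\<forall>m<p. (w ! m, w ! Suc m) \<notin> L)) \<and>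
       d = ((w ! p, w ! Suc p), take (Suc p) w, drop (Suc p) w))" for w d
    by (cases d; cases "fst d") (simp only: prod.case fst_conv walk_link_split_iff[OF assms(5)])
  have via_N: "w \<in> walks n g i j \<and> (\<exists>k<walk_length w. 0 < k \<and> w ! k \<in> A)"
    if "w \<in> walks_via_nodes n g A i j" for w
    using that by (auto simp: walks_via_nodes_def)
  have via_K: "w \<in> walks n g i j \<and> (\<exists>p<walk_length w. (w ! p, w ! Suc p) \<in> L)"
    if "w \<in> walks_via_links n g L i j" for w
    using that by (auto simp: walks_via_links_def)
  show ex1_N: "\<exists>!d. ?N w d" if "w \<in> walks_via_nodes n g A i j" for w
    using ex1_first_image[of "walk_length w" "\<lambda>k. 0 < k \<and> w ! k \<in> A"] via_N[OF that]
    unfolding N by simp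
  show ex1_K: "\<exists>!d. ?K w d" if "w \<in> walks_via_links n g L i j" for w
    using ex1_first_image[of "walk_length w" "\<lambda>p. (w ! p, w ! Suc p) \<in> L"] via_K[OF that]
    unfolding K by simp
  \<comment> \<open>Membership in the union of products means that some decomposition exists. The
    existence half of \<open>ex1_N\<close> gives one inclusion; for the other, the cut of a
    decomposition is itself an intermediate position with its node in \<open>A\<close>.\<close>
  have "w \<in> walks_via_nodes n g A i j \<longleftrightarrow> (\<exists>d. ?N w d)" for w
  proof
    show "\<exists>d. ?N w d" if "w \<in> walks_via_nodes n g A i j" using ex1_N[OF that] by (rule ex1_implies_ex)
    show "w \<in> walks_via_nodes n g A i j" if "\<exists>d. ?N w d"
      using that unfolding N walks_via_nodes_def by force
  qed
  then show "walks_via_nodes n g A i j =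
      (\<Union>l\<in>A. (walks_avoiding_nodes n g A i l - {[i]}) \<odot>\<^sub>S (walks n g l j - {[j]}))"
    by (auto simp: walk_set_concat_def; blast)
  \<comment> \<open>For links, the cutting position likewise witnesses that the walk uses a link of
    \<open>L\<close>.\<close>
  have "w \<in> walks_via_links n g L i j \<longleftrightarrow> (\<exists>d. ?K w d)" for w
  proof
    show "\<exists>d. ?K w d" if "w \<in> walks_via_links n g L i j" using ex1_K[OF that] by (rule ex1_implies_ex)
    show "w \<in> walks_via_links n g L i j" if "\<exists>d. ?K w d"
      using that unfolding K walks_via_links_def by force
  qed
  then show "walks_via_links n g L i j =
      (\<Union>(l, k)\<in>L. walks_avoiding_links n g L i l \<odot>\<^sub>S {[l, k]} \<odot>\<^sub>S walks n g k j)"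
    by (auto simp: walk_set_concat_def; blast)
qed

end
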